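(* Let $L$ be an infinite locally compact Hausdorff topological space, and let $\mathcal{A}$ be a somewhat regular linear subspace of $C_0(L)$. Then $\mathcal{A}$ (with the supremum norm) has the symmetric strong diameter $2$ property.
   Context: $\mathbb{K}$ denotes either $\mathbb{R}$ or $\mathbb{C}$, and $C_0(L)$ is the Banach space of continuous $\mathbb{K}$-valued functions on $L$ vanishing at infinity, with the supremum norm. A linear subspace $\mathcal{A}$ of $C_0(L)$ (not necessarily closed) is called somewhat regular if, whenever $V$ is a non-empty open subset of $L$ and $0<\varepsilon<1$, there is an $f\in\mathcal{A}$ such that $\|f\|=1$ and $|f(x)|\leq\varepsilon$ for every $x\in L\setminus V$. For a normed space $X$ with closed unit ball $B_X$, a slice of $B_X$ is a set of the form $S(x^\ast,\alpha)=\{x\in B_X\colon \operatorname{Re}x^\ast(x)>1-\alpha\}$, where $x^\ast\in X^\ast$ with $\|x^\ast\|=1$ and $\alpha>0$. $X$ has the symmetric strong diameter $2$ property (SSD2P) if whenever $n\in\mathbb{N}$, $S_1,\dots,S_n$ are slices of $B_X$, and $\varepsilon>0$, there exist $x_i\in S_i$, $i=1,\dots,n$, and $y\in B_X$ such that $x_i\pm y\in S_i$ for every $i\in\{1,\dots,n\}$ and $\|y\|>1-\varepsilon$. *)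

theory Defs
  imports "HOL-Analysis.Analysis"
begin

text \<open>
  The scalar field is a type \<open>'k\<close> of sort \<open>{real_normed_field, real_inner}\<close>, to be instantiated
  by \<^typ>\<open>real\<close> and \<^typ>\<open>complex\<close>. On both, the inner product with 1 is the real part.
\<close>

definition re_part :: "'k::{real_normed_field, real_inner} \<Rightarrow> real"
  where "re_part z = inner z 1"

lemma re_part_real [simp]: "re_part (x::real) = x"
  by (simp add: re_part_def)

lemma re_part_complex [simp]: "re_part (z::complex) = Re z"
  by (simp add: re_part_def inner_complex_def)


subsection \<open>Slices and the symmetric strong diameter 2 property\<close>

text \<open>
  A normed space over \<open>'k\<close> is given as a \<open>'k\<close>-linear subspace \<open>X\<close> of a type \<open>'v\<close>, with scalar
  multiplication \<open>scl\<close> and the norm of \<open>'v\<close>. An element of the dual of \<open>X\<close> is represented by any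
  function on \<open>'v\<close> whose restriction to \<open>X\<close> is that functional; values outside \<open>X\<close> are ignored.
\<close>

definition unit_ball_of :: "'v::real_normed_vector set \<Rightarrow> 'v set"
  where "unit_ball_of X = {x \<in> X. norm x \<le> 1}"

definition bounded_functional_on ::
  "('k::{real_normed_field, real_inner} \<Rightarrow> 'v::real_normed_vector \<Rightarrow> 'v) \<Rightarrow> 'v set \<Rightarrow> ('v \<Rightarrow> 'k) \<Rightarrow> bool"
  where "bounded_functional_on scl X \<phi> \<longleftrightarrow>
    (\<forall>x\<in>X. \<forall>y\<in>X. \<phi> (x + y) = \<phi> x + \<phi> y) \<and>
    (\<forall>c. \<forall>x\<in>X. \<phi> (scl c x) = c * \<phi> x) \<and>
    (\<exists>B. \<forall>x\<in>X. norm (\<phi> x) \<le> B * norm x)"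

definition dual_norm :: "'v::real_normed_vector set \<Rightarrow> ('v \<Rightarrow> 'k::{real_normed_field, real_inner}) \<Rightarrow> real"
  where "dual_norm X \<phi> = (SUP x\<in>unit_ball_of X. norm (\<phi> x))"

definition slice ::
  "'v::real_normed_vector set \<Rightarrow> ('v \<Rightarrow> 'k::{real_normed_field, real_inner}) \<Rightarrow> real \<Rightarrow> 'v set"
  where "slice X \<phi> \<alpha> = {x \<in> unit_ball_of X. re_part (\<phi> x) > 1 - \<alpha>}"

definition is_slice ::
  "('k::{real_normed_field, real_inner} \<Rightarrow> 'v::real_normed_vector \<Rightarrow> 'v) \<Rightarrow> 'v set \<Rightarrow> 'v set \<Rightarrow> bool"
  where "is_slice scl X S \<longleftrightarrow>
    (\<exists>\<phi> \<alpha>. bounded_functional_on scl X \<phi> \<and> dual_norm X \<phi> = 1 \<and> \<alpha> > 0 \<and> S = slice X \<phi> \<alpha>)"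

definition SSD2P ::
  "('k::{real_normed_field, real_inner} \<Rightarrow> 'v::real_normed_vector \<Rightarrow> 'v) \<Rightarrow> 'v set \<Rightarrow> bool"
  where "SSD2P scl X \<longleftrightarrow>
    (\<forall>n\<ge>1. \<forall>S :: nat \<Rightarrow> 'v set. \<forall>\<epsilon>>0. (\<forall>i\<in>{1..n}. is_slice scl X (S i)) \<longrightarrow>
      (\<exists>x. \<exists>y\<in>unit_ball_of X.
        (\<forall>i\<in>{1..n}. x i \<in> S i \<and> x i + y \<in> S i \<and> x i - y \<in> S i) \<and> norm y > 1 - \<epsilon>))"


subsection \<open>The space of continuous functions vanishing at infinity\<close>

text \<open>
  It is realised inside the type of bounded continuous functions, whose norm is the supremum norm
  and which carries only a real scalar multiplication in the library.
\<close>

definition scale_bcontfun ::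
  "'k::real_normed_field \<Rightarrow> ('a::topological_space \<Rightarrow>\<^sub>C 'k) \<Rightarrow> ('a \<Rightarrow>\<^sub>C 'k)"
  where "scale_bcontfun c f = Bcontfun (\<lambda>x. c * f x)"

lemma apply_scale_bcontfun [simp]: "scale_bcontfun c f x = c * f x"
proof -
  have "bounded (range (\<lambda>x. c * f x))"
    using bounded_linear_image[OF bounded_apply_bcontfun bounded_linear_mult_right[of c], of f]
    by (simp add: image_image)
  then have "(\<lambda>x. c * f x) \<in> bcontfun"
    by (auto simp: bcontfun_def intro!: continuous_intros)
  then show ?thesis
    by (simp add: scale_bcontfun_def Bcontfun_inverse)
qed

lemma vector_space_scale_bcontfun:
  "vector_space (scale_bcontfun :: 'k \<Rightarrow> ('a::topological_space \<Rightarrow>\<^sub>C 'k::real_normed_field) \<Rightarrow> _)"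
  by unfold_locales (auto intro!: bcontfun_eqI simp: plus_bcontfun.rep_eq algebra_simps)

lemma scale_bcontfun_real: "scale_bcontfun (c::real) f = c *\<^sub>R f"
  by (auto intro!: bcontfun_eqI simp: scaleR_bcontfun.rep_eq)

definition C0 :: "('a::topological_space \<Rightarrow>\<^sub>C 'k::real_normed_field) set"
  where "C0 = {f. \<forall>\<epsilon>>0. compact {x. norm (apply_bcontfun f x) \<ge> \<epsilon>}}"

definition somewhat_regular :: "('a::topological_space \<Rightarrow>\<^sub>C 'k::real_normed_field) set \<Rightarrow> bool"
  where "somewhat_regular A \<longleftrightarrow>
    (\<forall>V \<epsilon>. open V \<and> V \<noteq> {} \<and> 0 < \<epsilon> \<and> \<epsilon> < 1 \<longrightarrow>
      (\<exists>f\<in>A. norm f = 1 \<and> (\<forall>x. x \<notin> V \<longrightarrow> norm (apply_bcontfun f x) \<le> \<epsilon>)))"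

end

theory Submission
  imports Defs
begin

text \<open>
  Averaging peak functions supported, up to a small error, on a decreasing sequence of open sets
  yields a function \<open>f\<close> in the space whose values are almost in \<open>[0, 1]\<close>, which almost attains 1
  and is small off a prescribed open set \<open>V\<close>. If such functions are built on \<open>N\<close> disjoint sets \<open>V\<close>,
  all their unimodular combinations have norm at most 3, so for large \<open>N\<close> one of them is almost
  annihilated by finitely many given functionals. Given \<open>u\<close> in the slices and almost constant, with
  value \<open>c\<close>, on \<open>V\<close>, the functions \<open>u - c f \<plusminus> f\<close> have norm almost at most 1, because on \<open>V\<close>
  they are close to the convex combinations \<open>(1 - t) c \<plusminus> t\<close>. Rescaling puts them in the slices.
\<close>

section \<open>Scalar action, neighbourhoods and separation of points\<close>

interpretation scale_bcontfun: vector_space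
  "scale_bcontfun :: 'k \<Rightarrow> ('a::topological_space \<Rightarrow>\<^sub>C 'k::real_normed_field) \<Rightarrow> _"
  by (rule vector_space_scale_bcontfun)

lemma apply_bcontfun_sum: "apply_bcontfun (sum f S) x = (\<Sum>s\<in>S. apply_bcontfun (f s) x)"
  by (induction S rule: infinite_finite_induct) (auto simp: plus_bcontfun.rep_eq)

lemma open_bcontfun_near:
  fixes f :: "'a::topological_space \<Rightarrow>\<^sub>C 'k::real_normed_vector"
  shows "open {x. norm (f x - c) < \<delta>}"
  by (intro open_Collect_less continuous_intros continuous_on_apply_bcontfun)

lemma separate_finite_points:
  fixes F :: "'a::t2_space set"
  assumes "finite F"
  obtains U where "\<And>x. x \<in> F \<Longrightarrow> open (U x)" "\<And>x. x \<in> F \<Longrightarrow> x \<in> U x"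
    "\<And>x y. x \<in> F \<Longrightarrow> y \<in> F \<Longrightarrow> x \<noteq> y \<Longrightarrow> U x \<inter> U y = {}"
proof -
  have "\<forall>x y :: 'a. \<exists>G H. x \<noteq> y \<longrightarrow> open G \<and> open H \<and> x \<in> G \<and> y \<in> H \<and> G \<inter> H = {}"
  proof (intro allI)
    fix x y :: 'a
    show "\<exists>G H. x \<noteq> y \<longrightarrow> open G \<and> open H \<and> x \<in> G \<and> y \<in> H \<and> G \<inter> H = {}"
      using hausdorff[of x y] by (cases "x = y") auto
  qed
  then obtain G H :: "'a \<Rightarrow> 'a \<Rightarrow> 'a set" where GH: "\<And>x y. x \<noteq> y \<Longrightarrow>
      open (G x y) \<and> open (H x y) \<and> x \<in> G x y \<and> y \<in> H x y \<and> G x y \<inter> H x y = {}"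
    unfolding choice_iff by blast
  \<comment> \<open>The choice for \<open>(x, y)\<close> is unrelated to that for
    \<open>(y, x)\<close>, so both are intersected: then \<open>?U x\<close> lies in
    \<open>G x y\<close> and \<open>?U y\<close> in \<open>H x y\<close>, which are disjoint.
    Finiteness of \<open>F\<close> keeps the intersection open.\<close>
  let ?U = "\<lambda>x. \<Inter>y\<in>F - {x}. G x y \<inter> H y x"
  show thesis
  proof (rule that[of ?U])
    show "open (?U x)" for x
      using assms GH by (intro open_INT ballI open_Int) auto
    have "x \<in> G x y \<inter> H y x" if "y \<in> F - {x}" for x y
      using GH[of x y] GH[of y x] that by auto
    then show "x \<in> ?U x" for x
      by blast
    show "?U x \<inter> ?U y = {}" if "x \<in> F" "y \<in> F" "x \<noteq> y" for x y
      using GH[of x y] that by blast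
  qed
qed

section \<open>Peak functions in a somewhat regular subspace\<close>

text \<open>Division by the value at a point where the norm is nearly attained makes that value
  exactly 1. The price is an excess \<delta> in the norm.\<close>

lemma somewhat_regular_peak:
  fixes A :: "('a::topological_space \<Rightarrow>\<^sub>C 'k::real_normed_field) set"
  assumes sub: "module.subspace scale_bcontfun A" and reg: "somewhat_regular A"
    and V: "open V" "V \<noteq> {}" and \<delta>: "0 < \<delta>" "\<delta> < 1"
  obtains f p where "f \<in> A" "p \<in> V" "f p = 1" "\<And>x. norm (f x) \<le> 1 + \<delta>"
    "\<And>x. x \<notin> V \<Longrightarrow> norm (f x) \<le> \<delta>"
proof -
  \<comment> \<open>The bound is \<delta>/2 because the later division by \<open>g p\<close>, of
    norm above 1/2, at most doubles it; it also forces \<open>p\<close> into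
    \<open>V\<close>.\<close>
  obtain g where g: "g \<in> A" "norm g = 1" "\<And>x. x \<notin> V \<Longrightarrow> norm (g x) \<le> \<delta> / 2"
    using reg[unfolded somewhat_regular_def, rule_format, of V "\<delta> / 2"] V \<delta> by auto
  have "\<exists>p. norm (g p) > 1 / (1 + \<delta>)"
  proof (rule ccontr)
    assume "\<not> ?thesis"
    then have "norm (g x) \<le> 1 / (1 + \<delta>)" for x
      by (simp add: not_less)
    then have "norm g \<le> 1 / (1 + \<delta>)"
      by (rule norm_bound)
    then show False
      using g(2) \<delta> by (simp add: field_simps)
  qed
  then obtain p where p: "norm (g p) > 1 / (1 + \<delta>)" ..
  have "1 / (1 + \<delta>) > 1 / 2"
    using \<delta> by (simp add: field_simps)
  with p have half: "norm (g p) > 1 / 2"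
    by (rule less_trans[rotated])
  with \<delta> have half': "norm (g p) > \<delta> / 2"
    by linarith
  then have pV: "p \<in> V"
    using g(3)[of p] half' by force
  have nz: "g p \<noteq> 0" "norm (g p) > 0"
    using half by auto
  have one: "1 \<le> (1 + \<delta>) * norm (g p)"
    using p \<delta> by (simp add: field_simps)
  show thesis
  proof (rule that[of "scale_bcontfun (1 / g p) g" p])
    show "scale_bcontfun (1 / g p) g \<in> A"
      using sub g(1) by (rule scale_bcontfun.subspace_scale)
    show "p \<in> V" "scale_bcontfun (1 / g p) g p = 1"
      using pV nz by auto
    show "norm (scale_bcontfun (1 / g p) g x) \<le> 1 + \<delta>" for x
      using norm_bounded[of g x] g(2) one nz by (simp add: norm_mult norm_divide field_simps)
    show "norm (scale_bcontfun (1 / g p) g x) \<le> \<delta>" if "x \<notin> V" for x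
    proof -
      have "norm (g x) \<le> \<delta> * (1 / 2)"
        using g(3)[OF that] by simp
      also have "\<dots> \<le> \<delta> * norm (g p)"
        using half \<delta> by (intro mult_left_mono) auto
      finally show ?thesis
        using nz by (simp add: norm_mult norm_divide field_simps)
    qed
  qed
qed

text \<open>Each new peak is placed inside the set \<open>W\<close> where the previous sum is
  already close to its top value \<open>m\<close>. A point outside \<open>W\<close> gains at most
  \<delta>. A point of \<open>W\<close> may gain an uncontrolled amount of norm at most 1 +
  \<delta>, but there the sharper estimate by \<open>m * \<delta>\<close> is available, so the extra
  1 never accumulates.\<close>

lemma somewhat_regular_peak_sum:
  fixes A :: "('a::topological_space \<Rightarrow>\<^sub>C 'k::real_normed_field) set"
    and \<delta> :: real
  assumes sub: "module.subspace scale_bcontfun A" and reg: "somewhat_regular A"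
    and V: "open V" "V \<noteq> {}" and \<delta>: "0 < \<delta>" "\<delta> < 1"
  shows "\<exists>f\<in>A. \<exists>W\<subseteq>V. open W \<and> W \<noteq> {} \<and> (\<forall>x\<in>W. norm (f x - of_nat m) \<le> real m * \<delta>) \<and>
    (\<forall>x. x \<notin> V \<longrightarrow> norm (f x) \<le> real m * \<delta>) \<and>
    (\<forall>x. \<exists>t\<in>{0..real m}. norm (f x - of_real t) \<le> real m * \<delta> + 1)"
proof (induction m)
  case 0
  show ?case
    using scale_bcontfun.subspace_0[OF sub] V by (intro bexI[of _ 0] exI[of _ V]) auto
next
  case (Suc m)
  then obtain f W where f: "f \<in> A" and W: "W \<subseteq> V" "open W" "W \<noteq> {}"
    and fW: "\<And>x. x \<in> W \<Longrightarrow> norm (f x - of_nat m) \<le> real m * \<delta>"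
    and fV: "\<And>x. x \<notin> V \<Longrightarrow> norm (f x) \<le> real m * \<delta>"
    and ft: "\<And>x. \<exists>t\<in>{0..real m}. norm (f x - of_real t) \<le> real m * \<delta> + 1"
    by blast
  obtain g p where g: "g \<in> A" "p \<in> W" "g p = 1" "\<And>x. norm (g x) \<le> 1 + \<delta>"
    "\<And>x. x \<notin> W \<Longrightarrow> norm (g x) \<le> \<delta>"
    using somewhat_regular_peak[OF sub reg W(2,3) \<delta>] by metis
  \<comment> \<open>By continuity of \<open>g\<close> this is an open set around \<open>p\<close>,
    on which the new sum is close to \<open>Suc m\<close>.\<close>
  let ?W = "W \<inter> {x. norm (g x - 1) < \<delta>}"
  have "norm ((f + g) x - of_nat (Suc m)) \<le> real (Suc m) * \<delta>" if "x \<in> ?W" for x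
    using that fW[of x] norm_triangle_ineq[of "f x - of_nat m" "g x - 1"]
    by (simp add: plus_bcontfun.rep_eq algebra_simps)
  moreover have "norm ((f + g) x) \<le> real (Suc m) * \<delta>" if "x \<notin> V" for x
    using that fV[of x] g(5)[OF contra_subsetD[OF W(1) that]] norm_triangle_ineq[of "f x" "g x"]
    by (auto simp: plus_bcontfun.rep_eq algebra_simps)
  moreover have "\<exists>t\<in>{0..real (Suc m)}. norm ((f + g) x - of_real t) \<le> real (Suc m) * \<delta> + 1" for x
  proof (cases "x \<in> W")
    case True
    \<comment> \<open>All of \<open>g x\<close> goes into the error, with \<open>t = m\<close>; the
      estimate \<open>fW\<close> replaces \<open>ft\<close>, which already contains a 1.\<close>
    have "norm ((f + g) x - of_real (real m)) \<le> real (Suc m) * \<delta> + 1"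
      using fW[OF True] g(4)[of x] norm_triangle_ineq[of "f x - of_nat m" "g x"]
      by (simp add: plus_bcontfun.rep_eq algebra_simps)
    then show ?thesis
      by (intro bexI[of _ "real m"]) auto
  next
    case False
    obtain t where t: "t \<in> {0..real m}" "norm (f x - of_real t) \<le> real m * \<delta> + 1"
      using ft by blast
    have "norm ((f + g) x - of_real t) \<le> real (Suc m) * \<delta> + 1"
      using t(2) g(5)[OF False] norm_triangle_ineq[of "f x - of_real t" "g x"]
      by (simp add: plus_bcontfun.rep_eq algebra_simps)
    then show ?thesis
      using t(1) by (intro bexI[of _ t]) auto
  qed
  moreover have "f + g \<in> A"
    using sub f g(1) by (rule scale_bcontfun.subspace_add)
  moreover have "?W \<subseteq> V" "open ?W" "?W \<noteq> {}"
    using W g(2,3) \<delta> open_bcontfun_near[of g 1 \<delta>] by auto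
  ultimately show ?case
    by blast
qed

text \<open>Dividing a sum of \<open>m\<close> peaks by \<open>m\<close> shrinks the one
  uncontrolled jump from 1 to 1/\<open>m\<close>, while the other errors average to a single
  one.\<close>

lemma somewhat_regular_almost_unit_interval_valued:
  fixes A :: "('a::topological_space \<Rightarrow>\<^sub>C 'k::real_normed_field) set"
  assumes sub: "module.subspace scale_bcontfun A" and reg: "somewhat_regular A"
    and V: "open V" "V \<noteq> {}" and \<delta>: "0 < \<delta>"
  obtains f where "f \<in> A" "norm f \<ge> 1 - \<delta>" "\<And>x. x \<notin> V \<Longrightarrow> norm (f x) \<le> \<delta>"
    "\<And>x. \<exists>t\<in>{0..1}. norm (f x - of_real t) \<le> \<delta>"
proof -
  \<comment> \<open>One half of \<delta> pays for the averaged peak error, the other for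
    1/\<open>m\<close>; the cap 1/2 keeps \<gamma> below 1, as the peaks demand.\<close>
  define \<gamma> where "\<gamma> = min (\<delta> / 2) (1 / 2)"
  have \<gamma>: "0 < \<gamma>" "\<gamma> < 1" "\<gamma> \<le> \<delta> / 2"
    using \<delta> by (auto simp: \<gamma>_def)
  obtain m :: nat where m: "m > 0" "1 / real m < \<gamma>"
    using nat_approx_posE[OF \<gamma>(1)] by blast
  obtain f W where f: "f \<in> A" and W: "W \<noteq> {}"
    and fW: "\<And>x. x \<in> W \<Longrightarrow> norm (f x - of_nat m) \<le> real m * \<gamma>"
    and fV: "\<And>x. x \<notin> V \<Longrightarrow> norm (f x) \<le> real m * \<gamma>"
    and ft: "\<And>x. \<exists>t\<in>{0..real m}. norm (f x - of_real t) \<le> real m * \<gamma> + 1"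
    using somewhat_regular_peak_sum[OF sub reg V \<gamma>(1,2), of m] by metis
  define g where "g = scale_bcontfun (1 / of_nat m) f"
  have dist: "norm (g x - of_real (t / real m)) = norm (f x - of_real t) / real m" for x t
  proof -
    have "g x - of_real (t / real m) = (f x - of_real t) / of_nat m"
      using m by (simp add: g_def field_simps)
    then show ?thesis
      by (simp add: norm_divide)
  qed
  show thesis
  proof (rule that[of g])
    show "g \<in> A"
      unfolding g_def using sub f by (rule scale_bcontfun.subspace_scale)
    show "norm g \<ge> 1 - \<delta>"
    proof -
      obtain p where p: "p \<in> W"
        using W by blast
      have "norm (g p - 1) = norm (f p - of_nat m) / real m"
        using dist[of p m] m by simp
      also have "\<dots> \<le> real m * \<gamma> / real m"
        using fW[OF p] by (rule divide_right_mono) simp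
      finally have "norm (g p - 1) \<le> \<gamma>"
        using m by simp
      then show ?thesis
        using norm_bounded[of g p] norm_triangle_ineq2[of 1 "g p"] \<gamma>
        by (simp add: norm_minus_commute)
    qed
    show "norm (g x) \<le> \<delta>" if "x \<notin> V" for x
    proof -
      have "norm (g x) = norm (f x) / real m"
        using dist[of x 0] by simp
      also have "\<dots> \<le> real m * \<gamma> / real m"
        using fV[OF that] by (rule divide_right_mono) simp
      finally show ?thesis
        using m \<gamma> \<delta> by simp
    qed
    show "\<exists>t\<in>{0..1}. norm (g x - of_real t) \<le> \<delta>" for x
    proof -
      obtain t where t: "t \<in> {0..real m}" "norm (f x - of_real t) \<le> real m * \<gamma> + 1"
        using ft by blast
      have "norm (g x - of_real (t / real m)) \<le> (real m * \<gamma> + 1) / real m"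
        unfolding dist using t(2) by (rule divide_right_mono) simp
      also have "\<dots> = \<gamma> + 1 / real m"
        using m by (simp add: field_simps)
      also have "\<dots> \<le> \<delta>"
        using m \<gamma> by simp
      finally show ?thesis
        using t(1) m by (intro bexI[of _ "t / m"]) auto
    qed
  qed
qed

section \<open>Functionals on peak functions over disjoint open sets\<close>

lemma bounded_functional_on_sum:
  fixes A :: "('a::topological_space \<Rightarrow>\<^sub>C 'k::{real_normed_field, real_inner}) set"
  assumes "module.subspace scale_bcontfun A" "bounded_functional_on scale_bcontfun A \<phi>"
    and "\<And>s. s \<in> S \<Longrightarrow> f s \<in> A"
  shows "\<phi> (\<Sum>s\<in>S. scale_bcontfun (c s) (f s)) = (\<Sum>s\<in>S. c s * \<phi> (f s))"
proof -
  have zero: "\<phi> 0 = 0"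
    using assms(2) scale_bcontfun.subspace_0[OF assms(1)]
    unfolding bounded_functional_on_def by (metis mult_zero_left scale_bcontfun.scale_zero_left)
  show ?thesis
    using assms(3)
  proof (induction S rule: infinite_finite_induct)
    case (insert s S)
    have "scale_bcontfun (c s) (f s) \<in> A" "(\<Sum>s\<in>S. scale_bcontfun (c s) (f s)) \<in> A"
      using insert.prems assms(1)
      by (auto intro!: scale_bcontfun.subspace_sum scale_bcontfun.subspace_scale)
    then show ?case
      using assms(2) insert unfolding bounded_functional_on_def by auto
  qed (use zero in auto)
qed

lemma obtain_phase:
  fixes z :: "'k::real_normed_field"
  obtains \<theta> where "norm \<theta> = 1" "\<theta> * z = of_real (norm z)"
proof (cases "z = 0")
  case False
  then show ?thesis
    using that[of "of_real (norm z) / z"] by (simp add: norm_divide)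
qed (use that[of 1] in auto)

text \<open>The alternative to a representing measure: \<open>\<phi>\<close> has small mass on most of the sets \<open>V s\<close>.\<close>

lemma sum_norm_functional_le:
  fixes A :: "('a::topological_space \<Rightarrow>\<^sub>C 'k::{real_normed_field, real_inner}) set"
    and f :: "'s \<Rightarrow> 'a \<Rightarrow>\<^sub>C 'k"
  assumes sub: "module.subspace scale_bcontfun A"
    and \<phi>: "bounded_functional_on scale_bcontfun A \<phi>" "\<And>x. x \<in> A \<Longrightarrow> norm (\<phi> x) \<le> norm x"
    and F: "finite F" "\<And>s. s \<in> F \<Longrightarrow> f s \<in> A"
    and disj: "\<And>s t. s \<in> F \<Longrightarrow> t \<in> F \<Longrightarrow> s \<noteq> t \<Longrightarrow> V s \<inter> V t = {}"
    and \<delta>: "0 \<le> \<delta>"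
    and small: "\<And>s x. s \<in> F \<Longrightarrow> x \<notin> V s \<Longrightarrow> norm (f s x) \<le> \<delta>"
    and bound: "\<And>s x. s \<in> F \<Longrightarrow> norm (f s x) \<le> M" and M: "0 \<le> M"
  shows "(\<Sum>s\<in>F. norm (\<phi> (f s))) \<le> M + real (card F) * \<delta>"
proof -
  have "\<exists>\<theta>. norm \<theta> = 1 \<and> \<theta> * \<phi> (f s) = of_real (norm (\<phi> (f s)))" for s
    by (rule obtain_phase) blast
  then obtain \<theta> where \<theta>: "\<And>s. norm (\<theta> s) = 1" "\<And>s. \<theta> s * \<phi> (f s) = of_real (norm (\<phi> (f s)))"
    by metis
  \<comment> \<open>The phases turn every summand of \<phi> \<open>h\<close> into a nonnegative
    real, so the sum to be estimated is \<open>norm\<close> (\<phi> \<open>h\<close>), hence at most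
    the supremum norm of \<open>h\<close>.\<close>
  define h where "h = (\<Sum>s\<in>F. scale_bcontfun (\<theta> s) (f s))"
  have hA: "h \<in> A"
    unfolding h_def using sub F(2)
    by (auto intro!: scale_bcontfun.subspace_sum scale_bcontfun.subspace_scale)
  have "norm (h x) \<le> M + real (card F) * \<delta>" for x
  proof -
    have "norm (h x) \<le> (\<Sum>s\<in>F. norm (f s x))"
      unfolding h_def apply_bcontfun_sum using \<theta>(1)
      by (intro order_trans[OF norm_sum]) (simp add: norm_mult)
    \<comment> \<open>By disjointness at most one \<open>V s\<close> contains \<open>x\<close>, so
      \<open>M\<close> is counted at most once.\<close>
    also have "\<dots> \<le> (\<Sum>s\<in>F. (if x \<in> V s then M else 0) + \<delta>)"
      using small bound \<delta> by (intro sum_mono) (simp add: add_increasing2)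
    also have "\<dots> = (\<Sum>s\<in>{s\<in>F. x \<in> V s}. M) + real (card F) * \<delta>"
      using F(1) by (simp add: sum.distrib flip: sum.inter_filter)
    also have "(\<Sum>s\<in>{s\<in>F. x \<in> V s}. M) \<le> M"
    proof -
      have "is_singleton {s\<in>F. x \<in> V s} \<or> {s\<in>F. x \<in> V s} = {}"
        using disj unfolding is_singleton_def by blast
      then show ?thesis
        using M by (auto simp: is_singleton_def simp del: Collect_empty_eq)
    qed
    finally show ?thesis
      by simp
  qed
  then have "norm h \<le> M + real (card F) * \<delta>"
    by (rule norm_bound)
  moreover have "\<phi> h = of_real (\<Sum>s\<in>F. norm (\<phi> (f s)))"
    unfolding h_def using bounded_functional_on_sum[OF sub \<phi>(1), of F f \<theta>] F(2) \<theta>(2) by simp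
  then have "norm (\<phi> h) = (\<Sum>s\<in>F. norm (\<phi> (f s)))"
    by (simp add: sum_nonneg del: of_real_sum)
  ultimately show ?thesis
    using \<phi>(2)[OF hA] by linarith
qed

text \<open>A pigeonhole argument: for each \<open>i\<close> the norms of the values at the peak
  functions over disjoint sets sum to at most 3, so with enough sets some peak function is nearly
  killed by all the functionals at once. Infinitely many points provide the sets, and continuity of
  the \<open>u i\<close> lets them be shrunk until each \<open>u i\<close> is almost constant on
  them.\<close>

lemma somewhat_regular_almost_annihilated:
  fixes A :: "('a::t2_space \<Rightarrow>\<^sub>C 'k::{real_normed_field, real_inner}) set"
  assumes inf: "infinite (UNIV :: 'a set)"
    and sub: "module.subspace scale_bcontfun A" and reg: "somewhat_regular A"
    and I: "finite I"
    and \<phi>: "\<And>i. i \<in> I \<Longrightarrow> bounded_functional_on scale_bcontfun A (\<phi> i)"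
      "\<And>i x. i \<in> I \<Longrightarrow> x \<in> A \<Longrightarrow> norm (\<phi> i x) \<le> norm x"
    and \<delta>: "0 < \<delta>"
  obtains f V q where "f \<in> A" "norm f \<ge> 1 - \<delta>"
    "\<And>i x. i \<in> I \<Longrightarrow> x \<in> V \<Longrightarrow> norm (apply_bcontfun (u i) x - u i q) \<le> \<delta>"
    "\<And>x. x \<notin> V \<Longrightarrow> norm (f x) \<le> \<delta>"
    "\<And>x. \<exists>t\<in>{0..1}. norm (f x - of_real t) \<le> \<delta>"
    "\<And>i. i \<in> I \<Longrightarrow> norm (\<phi> i f) \<le> \<delta>"
proof -
  obtain N :: nat where N: "3 * real (card I) / \<delta> < real N"
    using reals_Archimedean2 by blast
  obtain F :: "'a set" where F: "finite F" "card F = Suc N"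
    using infinite_arbitrarily_large[OF inf] by blast
  obtain U where U: "\<And>s. s \<in> F \<Longrightarrow> open (U s)" "\<And>s. s \<in> F \<Longrightarrow> s \<in> U s"
    "\<And>s t. s \<in> F \<Longrightarrow> t \<in> F \<Longrightarrow> s \<noteq> t \<Longrightarrow> U s \<inter> U t = {}"
    using separate_finite_points[OF F(1)] by metis
  define V where "V s = U s \<inter> (\<Inter>i\<in>I. {x. norm (u i x - u i s) < \<delta>})" for s
  have V: "open (V s)" "s \<in> V s" if "s \<in> F" for s
    using U that I \<delta> unfolding V_def by (auto intro!: open_Int open_INT open_bcontfun_near)
  have disj: "V s \<inter> V t = {}" if "s \<in> F" "t \<in> F" "s \<noteq> t" for s t
    using U(3)[OF that] by (auto simp: V_def)
  \<comment> \<open>As \<open>card F\<close> is \<open>Suc N\<close>, the small values off the sets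
    \<open>V s\<close> add up to at most 1, whatever the number of sets.\<close>
  define \<gamma> where "\<gamma> = min \<delta> (1 / Suc N)"
  have \<gamma>: "0 < \<gamma>" "\<gamma> \<le> \<delta>" "\<gamma> \<le> 1 / Suc N"
    using \<delta> by (auto simp: \<gamma>_def)
  have "\<exists>f. f \<in> A \<and> norm f \<ge> 1 - \<gamma> \<and> (\<forall>x. x \<notin> V s \<longrightarrow> norm (f x) \<le> \<gamma>) \<and>
      (\<forall>x. \<exists>t\<in>{0..1}. norm (f x - of_real t) \<le> \<gamma>)" if "s \<in> F" for s
    using somewhat_regular_almost_unit_interval_valued[OF sub reg _ _ \<gamma>(1), of "V s"] V[OF that]
    by (metis empty_iff)
  then obtain f where f: "\<And>s. s \<in> F \<Longrightarrow> f s \<in> A" "\<And>s. s \<in> F \<Longrightarrow> norm (f s) \<ge> 1 - \<gamma>"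
      "\<And>s x. s \<in> F \<Longrightarrow> x \<notin> V s \<Longrightarrow> norm (f s x) \<le> \<gamma>"
      "\<And>s x. s \<in> F \<Longrightarrow> \<exists>t\<in>{0..1}. norm (f s x - of_real t) \<le> \<gamma>"
    by metis
  have le2: "norm (f s x) \<le> 2" if s: "s \<in> F" for s x
  proof -
    obtain t where t: "t \<in> {0..1}" "norm (f s x - of_real t) \<le> \<gamma>"
      using f(4)[OF s] by blast
    have "\<gamma> \<le> 1"
      using \<gamma>(3) by (rule order_trans) simp
    then show ?thesis
      using t norm_triangle_sub[of "f s x" "of_real t"] by auto
  qed
  have sum3: "(\<Sum>s\<in>F. norm (\<phi> i (f s))) \<le> 3" if "i \<in> I" for i
  proof -
    have "(\<Sum>s\<in>F. norm (\<phi> i (f s))) \<le> 2 + real (card F) * \<gamma>"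
      by (rule sum_norm_functional_le[where V = V])
        (use sub \<phi> that F f le2 disj \<gamma> in auto)
    also have "\<dots> \<le> 3"
      using \<gamma>(3) F(2) by (simp add: field_simps)
    finally show ?thesis .
  qed
  have "\<exists>s\<in>F. \<forall>i\<in>I. norm (\<phi> i (f s)) \<le> \<delta>"
  proof (rule ccontr)
    assume *: "\<not> ?thesis"
    \<comment> \<open>If every \<open>s\<close> failed for some \<open>i\<close>, the double sum
      over \<open>F\<close> and \<open>I\<close> would be at least \<open>card F\<close> times
      \<delta>; summed in the other order it is at most \<open>3 * card I\<close>, which is below
      \<open>N\<close> times \<delta>.\<close>
    have "real (card F) * \<delta> = (\<Sum>s\<in>F. \<delta>)"
      by simp
    also have "\<dots> \<le> (\<Sum>s\<in>F. \<Sum>i\<in>I. norm (\<phi> i (f s)))"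
    proof (rule sum_mono)
      fix s assume "s \<in> F"
      then obtain i where "i \<in> I" "norm (\<phi> i (f s)) > \<delta>"
        using * by (meson not_le)
      then show "\<delta> \<le> (\<Sum>i\<in>I. norm (\<phi> i (f s)))"
        using member_le_sum[of i I "\<lambda>i. norm (\<phi> i (f s))"] I by simp
    qed
    also have "\<dots> = (\<Sum>i\<in>I. \<Sum>s\<in>F. norm (\<phi> i (f s)))"
      by (rule sum.swap)
    also have "\<dots> \<le> real (card I) * 3"
      using sum_mono[OF sum3, of I] by simp
    also have "\<dots> < N * \<delta>"
      using N \<delta> by (simp add: field_simps)
    finally show False
      using F(2) \<delta> by (simp add: algebra_simps)
  qed
  then obtain s where s: "s \<in> F" "\<And>i. i \<in> I \<Longrightarrow> norm (\<phi> i (f s)) \<le> \<delta>"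
    by blast
  show thesis
  proof (rule that[of "f s" "V s" s])
    show "norm (u i x - u i s) \<le> \<delta>" if "i \<in> I" "x \<in> V s" for i x
      using that by (auto simp: V_def intro: less_imp_le)
    show "\<exists>t\<in>{0..1}. norm (f s x - of_real t) \<le> \<delta>" for x
      using f(4)[OF s(1), of x] \<gamma>(2) by force
  qed (use s f(1,2)[OF s(1)] f(3)[OF s(1)] \<gamma>(2) in force)+
qed

section \<open>Real parts, dual norms and nonempty slices\<close>

lemma abs_re_part_le: "\<bar>re_part z\<bar> \<le> norm z"
  unfolding re_part_def using Cauchy_Schwarz_ineq2[of z 1] by simp

lemma re_part_of_real [simp]:
  "re_part (of_real r :: 'k::{real_normed_field, real_inner}) = r"
  by (simp add: re_part_def of_real_def flip: power2_norm_eq_inner)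

lemma norm_functional_le:
  fixes A :: "('a::topological_space \<Rightarrow>\<^sub>C 'k::{real_normed_field, real_inner}) set"
  assumes sub: "module.subspace scale_bcontfun A"
    and \<phi>: "bounded_functional_on scale_bcontfun A \<phi>" and x: "x \<in> A"
  shows "norm (\<phi> x) \<le> dual_norm A \<phi> * norm x"
proof -
  obtain B where B: "\<And>x. x \<in> A \<Longrightarrow> norm (\<phi> x) \<le> B * norm x"
    using \<phi> unfolding bounded_functional_on_def by blast
  \<comment> \<open>The supremum in \<open>dual_norm\<close> is an upper bound only once the values
    are known to be bounded. The sign of \<open>B\<close> is unknown, hence its absolute
    value.\<close>
  have "bdd_above ((\<lambda>x. norm (\<phi> x)) ` unit_ball_of A)"
  proof (rule bdd_aboveI2)
    fix y assume y: "y \<in> unit_ball_of A"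
    then have "norm (\<phi> y) \<le> B * norm y"
      using B by (simp add: unit_ball_of_def)
    also have "\<dots> \<le> \<bar>B\<bar> * 1"
      using y by (intro mult_mono) (auto simp: unit_ball_of_def)
    finally show "norm (\<phi> y) \<le> \<bar>B\<bar>" by simp
  qed
  then have le: "norm (\<phi> y) \<le> dual_norm A \<phi>" if "y \<in> unit_ball_of A" for y
    unfolding dual_norm_def using that by (rule cSUP_upper2) auto
  show ?thesis
  proof (cases "x = 0")
    case True
    then show ?thesis
      using B[OF x] by simp
  next
    case False
    define y where "y = scale_bcontfun (of_real (1 / norm x)) x"
    have "norm (y z) \<le> 1" for z
      using norm_bounded[of x z] False by (simp add: y_def norm_mult norm_divide field_simps)
    then have "norm y \<le> 1"
      by (rule norm_bound)
    then have "norm (\<phi> y) \<le> dual_norm A \<phi>"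
      using scale_bcontfun.subspace_scale[OF sub x] by (intro le) (simp add: y_def unit_ball_of_def)
    moreover have "\<phi> y = of_real (1 / norm x) * \<phi> x"
      using \<phi> x unfolding bounded_functional_on_def y_def by blast
    ultimately show ?thesis
      using False by (simp add: norm_mult norm_divide field_simps)
  qed
qed

text \<open>The norm gives a point where the modulus of \<phi> exceeds 1 - \<alpha>; multiplying it
  by a phase makes the value real, so that modulus and real part agree.\<close>

lemma slice_nonempty:
  fixes A :: "('a::topological_space \<Rightarrow>\<^sub>C 'k::{real_normed_field, real_inner}) set"
  assumes sub: "module.subspace scale_bcontfun A"
    and \<phi>: "bounded_functional_on scale_bcontfun A \<phi>" "dual_norm A \<phi> = 1" and "\<alpha> > 0"
  shows "slice A \<phi> \<alpha> \<noteq> {}"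
proof -
  have "0 \<in> unit_ball_of A"
    using scale_bcontfun.subspace_0[OF sub] by (simp add: unit_ball_of_def)
  then have "\<exists>x\<in>unit_ball_of A. norm (\<phi> x) > 1 - \<alpha>"
    using \<open>\<alpha> > 0\<close> \<phi>(2) cSUP_least[of "unit_ball_of A" "\<lambda>x. norm (\<phi> x)" "1 - \<alpha>"]
    unfolding dual_norm_def by force
  then obtain x where x: "x \<in> A" "norm x \<le> 1" "norm (\<phi> x) > 1 - \<alpha>"
    by (auto simp: unit_ball_of_def)
  obtain \<theta> where \<theta>: "norm \<theta> = 1" "\<theta> * \<phi> x = of_real (norm (\<phi> x))"
    by (rule obtain_phase)
  have "norm (scale_bcontfun \<theta> x z) \<le> 1" for z
    using norm_bounded[of x z] x(2) \<theta>(1) by (simp add: norm_mult)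
  then have "norm (scale_bcontfun \<theta> x) \<le> 1"
    by (rule norm_bound)
  moreover have "\<phi> (scale_bcontfun \<theta> x) = of_real (norm (\<phi> x))"
    using \<phi>(1) x(1) \<theta>(2) unfolding bounded_functional_on_def by metis
  ultimately have "scale_bcontfun \<theta> x \<in> slice A \<phi> \<alpha>"
    using scale_bcontfun.subspace_scale[OF sub x(1)] x(3) by (simp add: slice_def unit_ball_of_def)
  then show ?thesis
    by blast
qed

section \<open>Perturbation by a peak function and the diameter two property\<close>

text \<open>On \<open>V\<close> the value is close to (1 - \<open>t\<close>) \<open>u q\<close> +
  \<open>t\<close> \<sigma>, a convex combination of two scalars of norm at most 1; off
  \<open>V\<close> the perturbation is small. Leaving \<sigma> free covers the centre (\<sigma> = 0)
  and both symmetric points (\<sigma> = 1 and \<sigma> = -1) together.\<close>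

lemma norm_peak_perturbation_le:
  fixes f u :: "'a::topological_space \<Rightarrow>\<^sub>C 'k::real_normed_field"
  assumes u: "norm u \<le> 1" and \<sigma>: "norm \<sigma> \<le> 1" and \<delta>: "0 \<le> \<delta>"
    and uV: "\<And>x. x \<in> V \<Longrightarrow> norm (u x - u q) \<le> \<delta>"
    and fV: "\<And>x. x \<notin> V \<Longrightarrow> norm (f x) \<le> \<delta>"
    and ft: "\<And>x. \<exists>t\<in>{0..1}. norm (f x - of_real t) \<le> \<delta>"
  shows "norm (u + scale_bcontfun (\<sigma> - u q) f) \<le> 1 + 3 * \<delta>"
proof (rule norm_bound)
  fix x
  have ux: "norm (u z) \<le> 1" for z
    using norm_bounded[of u z] u by linarith
  have \<sigma>': "norm (\<sigma> - u q) \<le> 2"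
    using norm_triangle_ineq4[of \<sigma> "u q"] \<sigma> ux[of q] by linarith
  have prod: "norm ((\<sigma> - u q) * z) \<le> 2 * \<delta>" if "norm z \<le> \<delta>" for z
    unfolding norm_mult using \<sigma>' that by (intro mult_mono) auto
  show "norm ((u + scale_bcontfun (\<sigma> - u q) f) x) \<le> 1 + 3 * \<delta>"
  proof (cases "x \<in> V")
    case True
    obtain t where t: "t \<in> {0..1}" "norm (f x - of_real t) \<le> \<delta>"
      using ft by blast
    have "norm (of_real (1 - t) * u q + of_real t * \<sigma>) \<le> (1 - t) * norm (u q) + t * norm \<sigma>"
      using t(1) by (intro order_trans[OF norm_triangle_ineq]) (simp add: norm_mult del: of_real_diff)
    also have "\<dots> \<le> (1 - t) * 1 + t * 1"
      using t(1) ux \<sigma> by (intro add_mono mult_left_mono) auto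
    finally have c: "norm (of_real (1 - t) * u q + of_real t * \<sigma>) \<le> 1"
      by simp
    \<comment> \<open>The error is \<delta> from \<open>u\<close>, and 2 \<delta> from
      \<open>f\<close> because \<sigma> - \<open>u q\<close> has norm at most 2.\<close>
    have "(u + scale_bcontfun (\<sigma> - u q) f) x =
        (of_real (1 - t) * u q + of_real t * \<sigma>) + ((u x - u q) + (\<sigma> - u q) * (f x - of_real t))"
      by (simp add: plus_bcontfun.rep_eq algebra_simps)
    also have "norm \<dots> \<le> 1 + (\<delta> + 2 * \<delta>)"
      using c uV[OF True] prod[OF t(2)] by (intro norm_triangle_mono) auto
    finally show ?thesis
      by simp
  next
    case False
    have "norm ((u + scale_bcontfun (\<sigma> - u q) f) x) \<le> 1 + 2 * \<delta>"
      using ux prod[OF fV[OF False]]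
      by (simp add: plus_bcontfun.rep_eq) (intro norm_triangle_mono, auto)
    then show ?thesis
      using \<delta> by linarith
  qed
qed

text \<open>A single argument over a generic scalar type, so that the real and the complex case are
  both instances.\<close>

lemma SSD2P_somewhat_regular:
  fixes A :: "('a::t2_space \<Rightarrow>\<^sub>C 'k::{real_normed_field, real_inner}) set"
  assumes inf: "infinite (UNIV :: 'a set)"
    and sub: "module.subspace scale_bcontfun A" and reg: "somewhat_regular A"
  shows "SSD2P scale_bcontfun A"
  unfolding SSD2P_def
proof (intro allI impI)
  fix n :: nat and S :: "nat \<Rightarrow> ('a \<Rightarrow>\<^sub>C 'k) set" and \<epsilon> :: real
  assume "1 \<le> n" and \<epsilon>: "0 < \<epsilon>" and "\<forall>i\<in>{1..n}. is_slice scale_bcontfun A (S i)"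
  then obtain \<phi> \<alpha> where
    \<phi>: "\<And>i. i \<in> {1..n} \<Longrightarrow> bounded_functional_on scale_bcontfun A (\<phi> i)"
      "\<And>i. i \<in> {1..n} \<Longrightarrow> dual_norm A (\<phi> i) = 1"
    and \<alpha>: "\<And>i. i \<in> {1..n} \<Longrightarrow> \<alpha> i > 0"
    and S: "\<And>i. i \<in> {1..n} \<Longrightarrow> S i = slice A (\<phi> i) (\<alpha> i)"
    unfolding is_slice_def by metis
  have \<phi>le: "norm (\<phi> i x) \<le> norm x" if "i \<in> {1..n}" "x \<in> A" for i x
    using norm_functional_le[OF sub \<phi>(1) that(2)] \<phi>(2) that(1) by simp
  have "\<exists>u. u \<in> slice A (\<phi> i) (\<alpha> i)" if "i \<in> {1..n}" for i
    using slice_nonempty[OF sub \<phi> \<alpha>] that by blast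
  then obtain u where u: "\<And>i. i \<in> {1..n} \<Longrightarrow> u i \<in> slice A (\<phi> i) (\<alpha> i)"
    by metis
  \<comment> \<open>Besides \<epsilon>, this collects the margins by which the \<open>u i\<close>
    lie inside their slices. A sixth of the minimum suffices: the functionals lose at most 5
    \<delta>, the norm of \<open>y\<close> at most 4 \<delta>.\<close>
  define D where "D = insert \<epsilon> ((\<lambda>i. re_part (\<phi> i (u i)) - (1 - \<alpha> i)) ` {1..n})"
  define \<delta> where "\<delta> = Min D / 6"
  have D: "finite D" "D \<noteq> {}" "\<And>d. d \<in> D \<Longrightarrow> 0 < d"
    using \<epsilon> u by (auto simp: D_def slice_def)
  have "6 * \<delta> \<le> d" if "d \<in> D" for d
    using D(1) that by (simp add: \<delta>_def)
  then have \<delta>: "0 < \<delta>" "6 * \<delta> \<le> \<epsilon>"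
      "\<And>i. i \<in> {1..n} \<Longrightarrow> 6 * \<delta> \<le> re_part (\<phi> i (u i)) - (1 - \<alpha> i)"
    using D by (auto simp: \<delta>_def D_def)
  obtain f V q where f: "f \<in> A" "norm f \<ge> 1 - \<delta>"
    and uV: "\<And>i x. i \<in> {1..n} \<Longrightarrow> x \<in> V \<Longrightarrow> norm (u i x - u i q) \<le> \<delta>"
    and fV: "\<And>x. x \<notin> V \<Longrightarrow> norm (f x) \<le> \<delta>"
    and ft: "\<And>x. \<exists>t\<in>{0..1}. norm (f x - of_real t) \<le> \<delta>"
    and \<phi>f: "\<And>i. i \<in> {1..n} \<Longrightarrow> norm (\<phi> i f) \<le> \<delta>"
    by (rule somewhat_regular_almost_annihilated[OF inf sub reg finite_atLeastAtMost, of 1 n \<phi> \<delta> u])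
      (erule \<phi>(1) | erule (1) \<phi>le | rule \<delta>(1) | (rule that; assumption))+
  \<comment> \<open>This undoes the excess norm from \<open>norm_peak_perturbation_le\<close>, at a
    cost of at most 3 \<delta>.\<close>
  define r where "r = 1 / (1 + 3 * \<delta>)"
  have r: "0 < r" "r \<le> 1" "r * (1 + 3 * \<delta>) = 1"
    using \<delta>(1) by (auto simp: r_def field_simps)
  have "1 - r = r * (3 * \<delta>)"
    using r(3) by (simp add: algebra_simps)
  also have "\<dots> \<le> 3 * \<delta>"
    using r \<delta>(1) by (intro mult_left_le_one_le) auto
  finally have r1: "1 - r \<le> 3 * \<delta>" .
  \<comment> \<open>The centre \<open>x i\<close> will be \<open>w 0 i\<close>. Since \<sigma>
    enters affinely with coefficient \<open>y\<close>, adding or subtracting \<open>y\<close> gives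
    \<open>w 1 i\<close> or \<open>w (-1) i\<close>, so one estimate of \<open>w\<close> serves all
    three points.\<close>
  define w where "w \<sigma> i = scale_bcontfun (of_real r) (u i + scale_bcontfun (\<sigma> - u i q) f)" for \<sigma> i
  define y where "y = scale_bcontfun (of_real r) f"
  have norm_scale: "norm (scale_bcontfun (of_real r) g) \<le> 1" if "norm g \<le> 1 + 3 * \<delta>"
    for g :: "'a \<Rightarrow>\<^sub>C 'k"
  proof (rule norm_bound)
    fix x
    have "r * norm (g x) \<le> r * (1 + 3 * \<delta>)"
      using norm_bounded[of g x] that r(1) by (intro mult_left_mono) auto
    then show "norm (scale_bcontfun (of_real r) g x) \<le> 1"
      using r by (simp add: norm_mult)
  qed
  have w_slice: "w \<sigma> i \<in> S i" if i: "i \<in> {1..n}" and \<sigma>: "norm \<sigma> \<le> 1" for i \<sigma>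
  proof -
    have ui: "u i \<in> A" "norm (u i) \<le> 1"
      using u[OF i] by (auto simp: slice_def unit_ball_of_def)
    have cA: "scale_bcontfun (\<sigma> - u i q) f \<in> A"
      by (rule scale_bcontfun.subspace_scale[OF sub f(1)])
    have sumA: "u i + scale_bcontfun (\<sigma> - u i q) f \<in> A"
      by (rule scale_bcontfun.subspace_add[OF sub ui(1) cA])
    have wA: "w \<sigma> i \<in> A"
      unfolding w_def by (rule scale_bcontfun.subspace_scale[OF sub sumA])
    have "norm (w \<sigma> i) \<le> 1"
      unfolding w_def
      by (intro norm_scale norm_peak_perturbation_le[where V = V]) (use ui \<sigma> \<delta>(1) uV i fV ft in auto)
    moreover have "re_part (\<phi> i (w \<sigma> i)) > 1 - \<alpha> i"
    proof -
      \<comment> \<open>The rescaling contributes 3 \<delta> and the perturbation 2 \<delta>, less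
        than the margin 6 \<delta> of \<open>u i\<close>.\<close>
      define e where "e = \<phi> i (w \<sigma> i) - \<phi> i (u i)"
      have "\<phi> i (w \<sigma> i) = of_real r * (\<phi> i (u i) + (\<sigma> - u i q) * \<phi> i f)"
        using \<phi>(1)[OF i] f(1) ui(1) cA sumA unfolding bounded_functional_on_def w_def by metis
      then have e: "e = - (of_real (1 - r) * \<phi> i (u i)) + of_real r * ((\<sigma> - u i q) * \<phi> i f)"
        by (simp add: e_def algebra_simps)
      have "norm (\<sigma> - u i q) \<le> 2"
        using norm_triangle_ineq4[of \<sigma> "u i q"] \<sigma> norm_bounded[of "u i" q] ui(2) by linarith
      then have "norm (of_real r * ((\<sigma> - u i q) * \<phi> i f)) \<le> 1 * (2 * \<delta>)"
        unfolding norm_mult using r \<phi>f[OF i] \<delta>(1) by (intro mult_mono) auto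
      moreover have "norm (of_real (1 - r) * \<phi> i (u i)) \<le> (3 * \<delta>) * 1"
        unfolding norm_mult using r r1 \<phi>le[OF i ui(1)] ui(2) \<delta>(1)
        by (intro mult_mono) (auto simp del: of_real_diff)
      ultimately have "norm e \<le> (3 * \<delta>) * 1 + 1 * (2 * \<delta>)"
        unfolding e by (intro norm_triangle_mono) (auto simp del: of_real_diff)
      then have "\<bar>re_part e\<bar> \<le> 5 * \<delta>"
        using abs_re_part_le[of e] by linarith
      moreover have "re_part (\<phi> i (w \<sigma> i)) = re_part (\<phi> i (u i)) + re_part e"
        by (simp add: e_def re_part_def inner_diff_left)
      ultimately show ?thesis
        using \<delta>(1) \<delta>(3)[OF i] by linarith
    qed
    ultimately show ?thesis
      unfolding S[OF i] using wA by (simp add: slice_def unit_ball_of_def)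
  qed
  have w_add: "w 0 i + y = w 1 i" "w 0 i - y = w (-1) i" for i
    by (auto intro!: bcontfun_eqI simp: w_def y_def plus_bcontfun.rep_eq minus_bcontfun.rep_eq algebra_simps)
  have yA: "y \<in> A"
    unfolding y_def by (rule scale_bcontfun.subspace_scale[OF sub f(1)])
  have "norm (f x) \<le> 1 + 3 * \<delta>" for x
  proof -
    obtain t where "t \<in> {0..1}" "norm (f x - of_real t) \<le> \<delta>"
      using ft by blast
    then show ?thesis
      using norm_triangle_sub[of "f x" "of_real t"] \<delta>(1) by auto
  qed
  then have "norm y \<le> 1"
    unfolding y_def by (intro norm_scale norm_bound)
  moreover have "norm y > 1 - \<epsilon>"
  proof -
    have "norm f \<le> norm y / r"
    proof (rule norm_bound)
      fix x show "norm (f x) \<le> norm y / r"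
        using norm_bounded[of y x] r(1) by (simp add: y_def norm_mult field_simps)
    qed
    then have "1 - \<delta> \<le> norm y / r"
      using f(2) by linarith
    then have "r * (1 - \<delta>) \<le> norm y"
      using r(1) by (simp add: field_simps)
    moreover have "r * \<delta> \<le> \<delta>"
      using r \<delta>(1) by (intro mult_left_le_one_le) auto
    moreover have "r * (1 - \<delta>) = r - r * \<delta>"
      by (simp add: algebra_simps)
    ultimately show ?thesis
      using r1 \<delta>(1,2) by linarith
  qed
  ultimately show "\<exists>x. \<exists>y\<in>unit_ball_of A.
      (\<forall>i\<in>{1..n}. x i \<in> S i \<and> x i + y \<in> S i \<and> x i - y \<in> S i) \<and> norm y > 1 - \<epsilon>"
    using w_slice yA w_add by (intro exI[of _ "w 0"] bexI[of _ y]) (auto simp: unit_ball_of_def)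
qed

theorem theorem2p2:
  assumes "infinite (UNIV :: 'a::t2_space set)"
    and "locally_compact_space (euclidean :: 'a topology)"
  shows "(\<forall>A :: ('a \<Rightarrow>\<^sub>C real) set.
            module.subspace scale_bcontfun A \<and> A \<subseteq> C0 \<and> somewhat_regular A \<longrightarrow>
              SSD2P scale_bcontfun A) \<and>
         (\<forall>A :: ('a \<Rightarrow>\<^sub>C complex) set.
            module.subspace scale_bcontfun A \<and> A \<subseteq> C0 \<and> somewhat_regular A \<longrightarrow>
              SSD2P scale_bcontfun A)"
  by (intro conjI allI impI; elim conjE) (rule SSD2P_somewhat_regular[OF assms(1)]; assumption)+

end
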